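(* For every integer $n\ge0$, the misère monoid $\mathcal{M}_{\mathrm{cl}(\mathsf{L}(\tau^{2n+1}))}$ has exactly four elements, namely the equivalence classes of $0$, $*$, $*+*$ and $\mathsf{L}(\tau^{2n+1})$.
   Context: A position $\xi=\{\xi^L \mid \xi^R\}$ is given recursively by finite sets of Left and Right options; $\cdot$ denotes an empty set. $0=\{\cdot\mid\cdot\}$, $*=\{0\mid0\}$, $\tau^0=*$, $\tau^k=\{\tau^{k-1}\mid\tau^{k-1}\}$ for $k\ge1$, and $\mathsf{L}(\xi)=\{\xi\mid\cdot\}$. Disjunctive sum: $\alpha+\beta=\{\alpha^L+\beta,\alpha+\beta^L \mid \alpha^R+\beta,\alpha+\beta^R\}$. Under misère play a player unable to move on their turn wins; $o^-$ denotes misère outcome ($\mathcal{L}$, $\mathcal{R}$, $\mathcal{N}$ next player wins, $\mathcal{P}$ next player loses). $\mathrm{cl}(\xi)$ is the smallest set containing $\xi$ closed under disjunctive sum and taking options. For closed $\Gamma$, $\alpha\equiv\beta\pmod\Gamma$ iff $o^-(\alpha+\gamma)=o^-(\beta+\gamma)$ for all $\gamma\in\Gamma$; the misère monoid $\mathcal{M}_\Gamma$ is the set of $\equiv$-classes with the monoid operation induced by disjunctive sum. *)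

theory Defs
  imports "HOL-Library.FSet" "HOL-Algebra.Group"
begin

datatype game = Game (left_opts: "game fset") (right_opts: "game fset")

lemma size_left_opt [termination_simp]: "x |\<in>| A \<Longrightarrow> size x < size (Game A B)"
  using member_le_sum[of x "fset A" "\<lambda>x. Suc (size x)"] by simp

lemma size_right_opt [termination_simp]: "x |\<in>| B \<Longrightarrow> size x < size (Game A B)"
  using member_le_sum[of x "fset B" "\<lambda>x. Suc (size x)"] by simp

lemma fimage_fundef_cong [fundef_cong]:
  "A = B \<Longrightarrow> (\<And>x. x |\<in>| B \<Longrightarrow> f x = g x) \<Longrightarrow> f |`| A = g |`| B"
  by (rule fset.map_cong)

instantiation game :: comm_monoid_add
begin

definition zero_game :: game where
  "0 = Game {||} {||}"

function plus_game :: "game \<Rightarrow> game \<Rightarrow> game" where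
  "plus_game (Game A B) (Game C D) =
     Game ((\<lambda>x. plus_game x (Game C D)) |`| A |\<union>| (\<lambda>y. plus_game (Game A B) y) |`| C)
          ((\<lambda>x. plus_game x (Game C D)) |`| B |\<union>| (\<lambda>y. plus_game (Game A B) y) |`| D)"
  by pat_completeness auto
termination
  by (relation "measure (\<lambda>(x, y). size x + size y)")
     (auto simp del: game.size dest: size_left_opt size_right_opt)

instance
proof
  fix a b c :: game
  show "a + b + c = a + (b + c)"
  proof (induction "size a + size b + size c" arbitrary: a b c rule: less_induct)
    case less
    obtain A A' B B' C C' where g: "a = Game A A'" "b = Game B B'" "c = Game C C'"
      by (meson game.exhaust)
    have 1: "x + b + c = x + (b + c)" if "x |\<in>| A \<or> x |\<in>| A'" for x
      using less[of x b c] that size_left_opt[of x A A'] size_right_opt[of x A' A]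
      unfolding g(1) by linarith
    have 2: "a + x + c = a + (x + c)" if "x |\<in>| B \<or> x |\<in>| B'" for x
      using less[of a x c] that size_left_opt[of x B B'] size_right_opt[of x B' B]
      unfolding g(2) by linarith
    have 3: "a + b + x = a + (b + x)" if "x |\<in>| C \<or> x |\<in>| C'" for x
      using less[of a b x] that size_left_opt[of x C C'] size_right_opt[of x C' C]
      unfolding g(3) by linarith
    show ?case
      using 1 2 3 unfolding g
      by (simp add: fimage_funion fimage_fimage funion_assoc cong: fimage_fundef_cong)
  qed
next
  fix a b :: game
  show "a + b = b + a"
  proof (induction "size a + size b" arbitrary: a b rule: less_induct)
    case less
    obtain A A' B B' where g: "a = Game A A'" "b = Game B B'"
      by (meson game.exhaust)
    have 1: "x + b = b + x" if "x |\<in>| A \<or> x |\<in>| A'" for x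
      using less[of x b] that size_left_opt[of x A A'] size_right_opt[of x A' A]
      unfolding g(1) by linarith
    have 2: "a + x = x + a" if "x |\<in>| B \<or> x |\<in>| B'" for x
      using less[of a x] that size_left_opt[of x B B'] size_right_opt[of x B' B]
      unfolding g(2) by linarith
    show ?case
      using 1 2 unfolding g
      by (simp add: funion_commute cong: fimage_fundef_cong)
  qed
next
  fix a :: game
  show "0 + a = a"
  proof (induction a)
    case (Game A B)
    then show ?case
      by (simp add: zero_game_def cong: fimage_fundef_cong)
  qed
qed

end

definition star :: game where
  "star = Game {|0|} {|0|}"

fun tau :: "nat \<Rightarrow> game" where
  "tau 0 = star"
| "tau (Suc k) = Game {|tau k|} {|tau k|}"

definition LL :: "game \<Rightarrow> game" where
  "LL \<xi> = Game {|\<xi>|} {||}"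

text \<open>\<open>left_wins_first \<xi>\<close> and \<open>right_wins_first \<xi>\<close>: the named player, moving first, wins
  under misere play; a player with no move on their turn wins.\<close>

function left_wins_first :: "game \<Rightarrow> bool" and right_wins_first :: "game \<Rightarrow> bool" where
  "left_wins_first (Game A B) \<longleftrightarrow> A = {||} \<or> fBex A (\<lambda>x. \<not> right_wins_first x)"
| "right_wins_first (Game A B) \<longleftrightarrow> B = {||} \<or> fBex B (\<lambda>x. \<not> left_wins_first x)"
  by pat_completeness auto
termination
  by (relation "measure (\<lambda>s. case s of Inl x \<Rightarrow> size x | Inr x \<Rightarrow> size x)")
     (auto simp del: game.size dest: size_left_opt size_right_opt)

datatype outcome = Outcome_L | Outcome_R | Outcome_N | Outcome_P

definition misere_outcome :: "game \<Rightarrow> outcome" where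
  "misere_outcome \<xi> =
     (if left_wins_first \<xi>
      then (if right_wins_first \<xi> then Outcome_N else Outcome_L)
      else (if right_wins_first \<xi> then Outcome_R else Outcome_P))"

definition closed_games :: "game set \<Rightarrow> bool" where
  "closed_games \<Gamma> \<longleftrightarrow>
     (\<forall>\<alpha>\<in>\<Gamma>. \<forall>\<beta>\<in>\<Gamma>. \<alpha> + \<beta> \<in> \<Gamma>) \<and>
     (\<forall>\<alpha>\<in>\<Gamma>. fset (left_opts \<alpha>) \<subseteq> \<Gamma> \<and> fset (right_opts \<alpha>) \<subseteq> \<Gamma>)"

definition cl :: "game \<Rightarrow> game set" where
  "cl \<xi> = \<Inter>{\<Gamma>. \<xi> \<in> \<Gamma> \<and> closed_games \<Gamma>}"

definition equiv_mod :: "game set \<Rightarrow> game \<Rightarrow> game \<Rightarrow> bool" where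
  "equiv_mod \<Gamma> \<alpha> \<beta> \<longleftrightarrow> (\<forall>\<gamma>\<in>\<Gamma>. misere_outcome (\<alpha> + \<gamma>) = misere_outcome (\<beta> + \<gamma>))"

definition misere_class :: "game set \<Rightarrow> game \<Rightarrow> game set" where
  "misere_class \<Gamma> \<alpha> = {\<beta> \<in> \<Gamma>. equiv_mod \<Gamma> \<alpha> \<beta>}"

text \<open>The multiplication is a union over representatives; for closed \<open>\<Gamma>\<close> all of them give
  the same class, see \<open>misere_monoid_mult\<close> below.\<close>

definition misere_monoid :: "game set \<Rightarrow> game set monoid" where
  "misere_monoid \<Gamma> =
     \<lparr>carrier = misere_class \<Gamma> ` \<Gamma>,
      mult = (\<lambda>X Y. \<Union>\<alpha>\<in>X. \<Union>\<beta>\<in>Y. misere_class \<Gamma> (\<alpha> + \<beta>)),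
      one = misere_class \<Gamma> 0\<rparr>"

lemma cl_self: "\<xi> \<in> cl \<xi>"
  by (auto simp: cl_def)

lemma closed_games_cl: "closed_games (cl \<xi>)"
  unfolding closed_games_def cl_def by blast

lemma cl_least: "\<xi> \<in> \<Gamma> \<Longrightarrow> closed_games \<Gamma> \<Longrightarrow> cl \<xi> \<subseteq> \<Gamma>"
  by (auto simp: cl_def)

lemma zero_in_closed:
  assumes "closed_games \<Gamma>" "\<alpha> \<in> \<Gamma>"
  shows "0 \<in> \<Gamma>"
  using assms(2)
proof (induction \<alpha>)
  case (Game A B)
  show ?case
  proof (cases "A = {||} \<and> B = {||}")
    case True
    then show ?thesis using Game.prems by (simp add: zero_game_def)
  next
    case False
    then obtain x where "x |\<in>| A \<or> x |\<in>| B" by blast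
    moreover have "fset A \<subseteq> \<Gamma>" "fset B \<subseteq> \<Gamma>"
      using assms(1) Game.prems unfolding closed_games_def by force+
    ultimately show ?thesis using Game.IH by blast
  qed
qed

lemma misere_class_eq_iff:
  assumes "\<alpha> \<in> \<Gamma>" "\<beta> \<in> \<Gamma>"
  shows "misere_class \<Gamma> \<alpha> = misere_class \<Gamma> \<beta> \<longleftrightarrow> equiv_mod \<Gamma> \<alpha> \<beta>"
  using assms unfolding misere_class_def equiv_mod_def by fastforce

lemma equiv_mod_add:
  assumes "closed_games \<Gamma>" "\<alpha> \<in> \<Gamma>" "\<beta>' \<in> \<Gamma>"
    and "equiv_mod \<Gamma> \<alpha> \<alpha>'" "equiv_mod \<Gamma> \<beta> \<beta>'"
  shows "equiv_mod \<Gamma> (\<alpha> + \<beta>) (\<alpha>' + \<beta>')"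
  unfolding equiv_mod_def
proof
  fix \<gamma> assume \<gamma>: "\<gamma> \<in> \<Gamma>"
  have "misere_outcome (\<alpha> + \<beta> + \<gamma>) = misere_outcome (\<beta> + (\<alpha> + \<gamma>))"
    by (simp add: ac_simps)
  also have "\<dots> = misere_outcome (\<beta>' + (\<alpha> + \<gamma>))"
    using assms \<gamma> by (simp add: equiv_mod_def closed_games_def)
  also have "\<dots> = misere_outcome (\<alpha> + (\<beta>' + \<gamma>))"
    by (simp add: ac_simps)
  also have "\<dots> = misere_outcome (\<alpha>' + (\<beta>' + \<gamma>))"
    using assms \<gamma> by (simp add: equiv_mod_def closed_games_def)
  finally show "misere_outcome (\<alpha> + \<beta> + \<gamma>) = misere_outcome (\<alpha>' + \<beta>' + \<gamma>)"
    by (simp add: ac_simps)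
qed

lemma misere_monoid_mult:
  assumes "closed_games \<Gamma>" "\<alpha> \<in> \<Gamma>" "\<beta> \<in> \<Gamma>"
  shows "misere_class \<Gamma> \<alpha> \<otimes>\<^bsub>misere_monoid \<Gamma>\<^esub> misere_class \<Gamma> \<beta> = misere_class \<Gamma> (\<alpha> + \<beta>)"
proof -
  have eq: "misere_class \<Gamma> (x + y) = misere_class \<Gamma> (\<alpha> + \<beta>)"
    if "x \<in> misere_class \<Gamma> \<alpha>" "y \<in> misere_class \<Gamma> \<beta>" for x y
  proof -
    have xy: "x \<in> \<Gamma>" "y \<in> \<Gamma>" "equiv_mod \<Gamma> \<alpha> x" "equiv_mod \<Gamma> \<beta> y"
      using that by (auto simp: misere_class_def)
    then have "equiv_mod \<Gamma> (\<alpha> + \<beta>) (x + y)"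
      using assms by (intro equiv_mod_add) auto
    moreover have "\<alpha> + \<beta> \<in> \<Gamma>" "x + y \<in> \<Gamma>"
      using assms xy unfolding closed_games_def by auto
    ultimately show ?thesis using misere_class_eq_iff by blast
  qed
  have mem: "\<alpha> \<in> misere_class \<Gamma> \<alpha>" "\<beta> \<in> misere_class \<Gamma> \<beta>"
    using assms by (auto simp: misere_class_def equiv_mod_def)
  have "(\<Union>x\<in>misere_class \<Gamma> \<alpha>. \<Union>y\<in>misere_class \<Gamma> \<beta>. misere_class \<Gamma> (x + y))
      = misere_class \<Gamma> (\<alpha> + \<beta>)"
    using eq mem by blast
  then show ?thesis by (simp add: misere_monoid_def)
qed

lemma misere_monoid_comm_monoid:
  assumes "closed_games \<Gamma>" "\<Gamma> \<noteq> {}"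
  shows "comm_monoid (misere_monoid \<Gamma>)"
proof -
  have z: "0 \<in> \<Gamma>" using assms zero_in_closed by blast
  have s: "\<alpha> + \<beta> \<in> \<Gamma>" if "\<alpha> \<in> \<Gamma>" "\<beta> \<in> \<Gamma>" for \<alpha> \<beta>
    using that assms(1) by (auto simp: closed_games_def)
  have c: "carrier (misere_monoid \<Gamma>) = misere_class \<Gamma> ` \<Gamma>"
    and o: "\<one>\<^bsub>misere_monoid \<Gamma>\<^esub> = misere_class \<Gamma> 0"
    by (simp_all add: misere_monoid_def)
  show ?thesis
    by (rule comm_monoidI)
       (auto simp: c o z s misere_monoid_mult[OF assms(1)] ac_simps)
qed

end

theory Submission
  imports Defs
begin

text \<open>Call \<open>G\<close> the generator. Every position of the closure is a sum of \<open>a\<close> copies of \<open>G\<close> and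
  of paths with \<open>m\<close> moves in total. Since the path inside \<open>G\<close> has even length, every move flips
  the parity of \<open>a + m\<close>, and the outcome only depends on this parity and on whether \<open>m = 0\<close>:
  it is N if \<open>a + m\<close> is even, and if \<open>a + m\<close> is odd it is P for \<open>m > 0\<close> and R for \<open>m = 0\<close>.
  These two data are additive, so they determine the class; the four cases are those of
  \<open>0\<close>, \<open>*\<close>, \<open>* + *\<close> and \<open>G\<close>.\<close>

section \<open>Paths, and moves in sums\<close>

text \<open>The index is the number of moves that play lasts, so \<open>0\<close>,
  \<open>star\<close> and all \<open>tau k\<close> become members of one family.\<close>

fun path :: "nat \<Rightarrow> game" where
  "path 0 = 0"
| "path (Suc k) = Game {|path k|} {|path k|}"

lemma tau_eq_path: "tau k = path (Suc k)"
  by (induction k) (simp_all add: star_def)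

lemma star_eq_path: "star = path 1"
  by (simp add: star_def)

lemma left_opts_zero [simp]: "left_opts 0 = {||}"
  by (simp add: zero_game_def)

lemma right_opts_zero [simp]: "right_opts 0 = {||}"
  by (simp add: zero_game_def)

lemma left_opts_plus:
  "left_opts (a + b) = (\<lambda>x. x + b) |`| left_opts a |\<union>| (\<lambda>y. a + y) |`| left_opts b"
  by (cases a; cases b) simp

lemma right_opts_plus:
  "right_opts (a + b) = (\<lambda>x. x + b) |`| right_opts a |\<union>| (\<lambda>y. a + y) |`| right_opts b"
  by (cases a; cases b) simp

lemma left_wins_first_iff:
  "left_wins_first g \<longleftrightarrow>
     left_opts g = {||} \<or> (\<exists>x. x |\<in>| left_opts g \<and> \<not> right_wins_first x)"
  by (cases g) auto

lemma right_wins_first_iff: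
  "right_wins_first g \<longleftrightarrow>
     right_opts g = {||} \<or> (\<exists>x. x |\<in>| right_opts g \<and> \<not> left_wins_first x)"
  by (cases g) auto

lemma size_left_opts: "x |\<in>| left_opts g \<Longrightarrow> size x < size g"
  by (cases g) (auto simp del: game.size dest: size_left_opt)

lemma size_right_opts: "x |\<in>| right_opts g \<Longrightarrow> size x < size g"
  by (cases g) (auto simp del: game.size dest: size_right_opt)

section \<open>Sums of paths and copies of the generator\<close>

text \<open>A relation rather than a function: the counts are read off a way of building the game as
  a sum.\<close>

inductive sum_of :: "nat \<Rightarrow> nat \<Rightarrow> nat \<Rightarrow> game \<Rightarrow> bool" for q where
  sum_of_path: "sum_of q 0 k (path k)"
| sum_of_LL: "sum_of q 1 0 (LL (path q))"
| sum_of_plus: "sum_of q a m g \<Longrightarrow> sum_of q b k h \<Longrightarrow> sum_of q (a + b) (m + k) (g + h)"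

text \<open>A move touches a single summand: it shortens a path by one, or turns a copy of the
  generator into \<open>path q\<close>, which adds \<open>q\<close> path moves.\<close>

lemma sum_of_left_opts:
  assumes "sum_of q a m g" "x |\<in>| left_opts g"
  shows "(\<exists>m'. m = Suc m' \<and> sum_of q a m' x) \<or> (\<exists>a'. a = Suc a' \<and> sum_of q a' (m + q) x)"
  using assms
proof (induction arbitrary: x)
  case (sum_of_path k)
  then show ?case by (cases k) (auto intro: sum_of.intros)
next
  case sum_of_LL
  then show ?case by (auto simp: LL_def intro: sum_of.intros)
next
  case (sum_of_plus a m g b k h)
  from sum_of_plus.prems consider
      y where "y |\<in>| left_opts g" "x = y + h" | y where "y |\<in>| left_opts h" "x = g + y"
    by (auto simp: left_opts_plus)
  then show ?case
  proof cases
    case 1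
    with sum_of_plus.IH(1)[of y] sum_of_plus.hyps(2) show ?thesis
      using sum_of.sum_of_plus[of q a _ y b k h] sum_of.sum_of_plus[of q _ "m + q" y b k h]
      by (auto simp: ac_simps)
  next
    case 2
    with sum_of_plus.IH(2)[of y] sum_of_plus.hyps(1) show ?thesis
      using sum_of.sum_of_plus[of q a m g b _ y] sum_of.sum_of_plus[of q a m g _ "k + q" y]
      by (auto simp: ac_simps)
  qed
qed

text \<open>Right has no move in \<open>LL (path q)\<close>, so only paths can be shortened and
  Right is stuck once \<open>m = 0\<close>.\<close>

lemma sum_of_right_opts:
  assumes "sum_of q a m g" "x |\<in>| right_opts g"
  shows "\<exists>m'. m = Suc m' \<and> sum_of q a m' x"
  using assms
proof (induction arbitrary: x)
  case (sum_of_path k)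
  then show ?case by (cases k) (auto intro: sum_of.intros)
next
  case sum_of_LL
  then show ?case by (auto simp: LL_def)
next
  case (sum_of_plus a m g b k h)
  from sum_of_plus.prems consider
      y where "y |\<in>| right_opts g" "x = y + h" | y where "y |\<in>| right_opts h" "x = g + y"
    by (auto simp: right_opts_plus)
  then show ?case
  proof cases
    case 1
    with sum_of_plus.IH(1)[of y] sum_of_plus.hyps(2) show ?thesis
      using sum_of.sum_of_plus[of q a _ y b k h] by auto
  next
    case 2
    with sum_of_plus.IH(2)[of y] sum_of_plus.hyps(1) show ?thesis
      using sum_of.sum_of_plus[of q a m g b _ y] by auto
  qed
qed

text \<open>Some path summand is nonempty, and its options are the same for both players, so one
  witness serves Left and Right.\<close>

lemma sum_of_path_move:
  assumes "sum_of q a m g" "m > 0"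
  shows "\<exists>x. x |\<in>| left_opts g \<and> x |\<in>| right_opts g \<and> sum_of q a (m - 1) x"
  using assms
proof induction
  case (sum_of_path k)
  then show ?case by (cases k) (auto intro: sum_of.intros)
next
  case sum_of_LL
  then show ?case by simp
next
  case (sum_of_plus a m g b k h)
  show ?case
  proof (cases "m > 0")
    case True
    with sum_of_plus.IH(1) obtain x
      where x: "x |\<in>| left_opts g" "x |\<in>| right_opts g" "sum_of q a (m - 1) x" by blast
    have "sum_of q (a + b) (m + k - 1) (x + h)"
      using sum_of.sum_of_plus[OF x(3) sum_of_plus.hyps(2)] True by simp
    with x show ?thesis
      by (intro exI[of _ "x + h"]) (auto simp: left_opts_plus right_opts_plus)
  next
    case False
    with sum_of_plus obtain x
      where x: "x |\<in>| left_opts h" "x |\<in>| right_opts h" "sum_of q b (k - 1) x" by auto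
    have "sum_of q (a + b) (m + k - 1) (g + x)"
      using sum_of.sum_of_plus[OF sum_of_plus.hyps(1) x(3)] False by simp
    with x show ?thesis
      by (intro exI[of _ "g + x"]) (auto simp: left_opts_plus right_opts_plus)
  qed
qed

lemma sum_of_LL_move:
  assumes "sum_of q a m g" "a > 0"
  shows "\<exists>x. x |\<in>| left_opts g \<and> sum_of q (a - 1) (m + q) x"
  using assms
proof induction
  case (sum_of_path k)
  then show ?case by simp
next
  case sum_of_LL
  then show ?case by (auto simp: LL_def intro: sum_of.intros)
next
  case (sum_of_plus a m g b k h)
  show ?case
  proof (cases "a > 0")
    case True
    with sum_of_plus.IH(1) obtain x
      where x: "x |\<in>| left_opts g" "sum_of q (a - 1) (m + q) x" by blast
    have "sum_of q (a + b - 1) (m + k + q) (x + h)"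
      using sum_of.sum_of_plus[OF x(2) sum_of_plus.hyps(2)] True by (simp add: ac_simps)
    with x show ?thesis
      by (intro exI[of _ "x + h"]) (auto simp: left_opts_plus)
  next
    case False
    with sum_of_plus obtain x
      where x: "x |\<in>| left_opts h" "sum_of q (b - 1) (k + q) x" by auto
    have "sum_of q (a + b - 1) (m + k + q) (g + x)"
      using sum_of.sum_of_plus[OF sum_of_plus.hyps(1) x(2)] False by (simp add: ac_simps)
    with x show ?thesis
      by (intro exI[of _ "g + x"]) (auto simp: left_opts_plus)
  qed
qed

section \<open>Misere outcomes\<close>

lemma sum_of_wins_first:
  assumes "even q" "q > 0" "sum_of q a m g"
  shows "(left_wins_first g \<longleftrightarrow> even (a + m)) \<and>
         (right_wins_first g \<longleftrightarrow> even (a + m) \<or> m = 0)"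
  using assms(3)
proof (induction "size g" arbitrary: g a m rule: less_induct)
  case less
  note g = less.prems
  have left_IH: "left_wins_first x \<longleftrightarrow> even (b + k)"
    if "x |\<in>| right_opts g" "sum_of q b k x" for x b k
    using less.hyps[OF size_right_opts] that by blast
  have right_IH: "right_wins_first x \<longleftrightarrow> even (b + k) \<or> k = 0"
    if "x |\<in>| left_opts g" "sum_of q b k x" for x b k
    using less.hyps[OF size_left_opts] that by blast
  have "left_wins_first g \<longleftrightarrow> even (a + m)"
  proof (cases "even (a + m)")
    case True
    consider "a = 0" "m = 0" | "a > 0" | "a = 0" "m > 0" by blast
    then have "left_wins_first g"
    proof cases
      case 1
      then have "left_opts g = {||}" using sum_of_left_opts[OF g] by fastforce
      then show ?thesis by (simp add: left_wins_first_iff)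
    next
      case 2
      \<comment> \<open>Left opens a generator because shortening a path might leave
        \<open>m = 0\<close>, where Right is stuck and wins; here at least \<open>q > 0\<close> path
        moves remain.\<close>
      from sum_of_LL_move[OF g 2] obtain x
        where x: "x |\<in>| left_opts g" "sum_of q (a - 1) (m + q) x" by blast
      have "\<not> right_wins_first x"
        using right_IH[OF x] True 2 assms(1,2) by simp
      with x(1) show ?thesis by (auto simp: left_wins_first_iff[of g])
    next
      case 3
      from sum_of_path_move[OF g 3(2)] obtain x
        where x: "x |\<in>| left_opts g" "sum_of q a (m - 1) x" by blast
      \<comment> \<open>Since \<open>m\<close> is even and positive, \<open>m - 1\<close> is odd and
        hence nonzero, so Right is not stuck.\<close>
      have "\<not> right_wins_first x"
        using right_IH[OF x] True 3 by (cases m) auto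
      with x(1) show ?thesis by (auto simp: left_wins_first_iff[of g])
    qed
    with True show ?thesis by simp
  next
    case False
    \<comment> \<open>An odd total makes \<open>a\<close> or \<open>m\<close> positive, so Left does
      not win by being stuck.\<close>
    have "left_opts g \<noteq> {||}"
      using sum_of_path_move[OF g] sum_of_LL_move[OF g] False by (cases "m > 0") auto
    moreover have "right_wins_first x" if "x |\<in>| left_opts g" for x
      using sum_of_left_opts[OF g that] right_IH[OF that] False assms(1) by fastforce
    ultimately show ?thesis using False by (auto simp: left_wins_first_iff[of g])
  qed
  moreover have "right_wins_first g \<longleftrightarrow> even (a + m) \<or> m = 0"
  proof (cases "m = 0")
    case True
    then have "right_opts g = {||}" using sum_of_right_opts[OF g] by fastforce
    with True show ?thesis by (simp add: right_wins_first_iff)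
  next
    case False
    then obtain x where x: "x |\<in>| right_opts g" "sum_of q a (m - 1) x"
      using sum_of_path_move[OF g] by blast
    show ?thesis
    proof (cases "even (a + m)")
      case True
      then have "\<not> left_wins_first x" using left_IH[OF x] False by (cases m) auto
      with x(1) True show ?thesis by (auto simp: right_wins_first_iff[of g])
    next
      case odd: False
      have "left_wins_first y" if "y |\<in>| right_opts g" for y
        using sum_of_right_opts[OF g that] left_IH[OF that] odd by fastforce
      \<comment> \<open>Here \<open>x\<close> serves only to show that Right has a move and does not
        win by being stuck.\<close>
      with x(1) odd False show ?thesis by (auto simp: right_wins_first_iff[of g])
    qed
  qed
  ultimately show ?case by blast
qed

lemma sum_of_misere_outcome:
  assumes "even q" "q > 0" "sum_of q a m g"
  shows "misere_outcome g =
    (if even (a + m) then Outcome_N else if m = 0 then Outcome_R else Outcome_P)"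
  using sum_of_wins_first[OF assms] by (simp add: misere_outcome_def)

section \<open>The closure and its equivalence\<close>

lemma cl_LL_path_sum_of:
  assumes "g \<in> cl (LL (path q))"
  obtains a m where "sum_of q a m g"
proof -
  have "closed_games {g. \<exists>a m. sum_of q a m g}"
    unfolding closed_games_def
  proof (intro conjI ballI subsetI)
    fix \<alpha> \<beta>
    assume "\<alpha> \<in> {g. \<exists>a m. sum_of q a m g}" "\<beta> \<in> {g. \<exists>a m. sum_of q a m g}"
    then show "\<alpha> + \<beta> \<in> {g. \<exists>a m. sum_of q a m g}"
      by (auto intro: sum_of_plus)
  next
    fix \<alpha> x
    assume "\<alpha> \<in> {g. \<exists>a m. sum_of q a m g}" "x |\<in>| left_opts \<alpha>"
    then show "x \<in> {g. \<exists>a m. sum_of q a m g}"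
      using sum_of_left_opts[of q _ _ \<alpha> x] by blast
  next
    fix \<alpha> x
    assume "\<alpha> \<in> {g. \<exists>a m. sum_of q a m g}" "x |\<in>| right_opts \<alpha>"
    then show "x \<in> {g. \<exists>a m. sum_of q a m g}"
      using sum_of_right_opts[of q _ _ \<alpha> x] by blast
  qed
  moreover have "LL (path q) \<in> {g. \<exists>a m. sum_of q a m g}"
    using sum_of_LL by blast
  ultimately have "cl (LL (path q)) \<subseteq> {g. \<exists>a m. sum_of q a m g}"
    by (intro cl_least)
  with assms that show thesis by auto
qed

text \<open>Adding \<open>\<gamma>\<close> adds its counts \<open>c\<close> and \<open>l\<close> on
  both sides. This preserves equal parity, and as counts are natural numbers, \<open>m + l\<close>
  vanishes only if both terms do.\<close>

lemma sum_of_equiv_mod: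
  assumes q: "even q" "q > 0" and g: "sum_of q a m g" and h: "sum_of q b k h"
    and parity: "even (a + m) \<longleftrightarrow> even (b + k)" and zero: "m = 0 \<longleftrightarrow> k = 0"
  shows "equiv_mod (cl (LL (path q))) g h"
  unfolding equiv_mod_def
proof
  fix \<gamma> assume "\<gamma> \<in> cl (LL (path q))"
  then obtain c l where \<gamma>: "sum_of q c l \<gamma>" by (rule cl_LL_path_sum_of)
  show "misere_outcome (g + \<gamma>) = misere_outcome (h + \<gamma>)"
    using parity zero
    by (auto simp: sum_of_misere_outcome[OF q sum_of_plus[OF g \<gamma>]]
        sum_of_misere_outcome[OF q sum_of_plus[OF h \<gamma>]])
qed

lemma path_in_closed:
  assumes "closed_games \<Gamma>" "path q \<in> \<Gamma>" "k \<le> q"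
  shows "path k \<in> \<Gamma>"
  using assms(3)
proof (induction rule: inc_induct)
  case base
  show ?case by (rule assms(2))
next
  case (step j)
  with assms(1) have "fset (left_opts (path (Suc j))) \<subseteq> \<Gamma>"
    unfolding closed_games_def by blast
  then show ?case by simp
qed

section \<open>The four classes\<close>

theorem theorem3p4p6:
  fixes n :: nat
  shows "let \<Gamma> = cl (LL (tau (2 * n + 1))) in
           carrier (misere_monoid \<Gamma>) =
             {misere_class \<Gamma> 0, misere_class \<Gamma> star, misere_class \<Gamma> (star + star),
              misere_class \<Gamma> (LL (tau (2 * n + 1)))}
           \<and> card (carrier (misere_monoid \<Gamma>)) = 4"
proof -
  \<comment> \<open>\<open>tau k\<close> is \<open>path (Suc k)\<close>, so the odd index
    \<open>2 * n + 1\<close> becomes an even length, positive also for \<open>n = 0\<close>.\<close>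
  define q where "q = 2 * n + 2"
  define G where "G = LL (path q)"
  define \<Gamma> where "\<Gamma> = cl G"
  have q: "even q" "q > 0" by (simp_all add: q_def)
  have tau: "LL (tau (2 * n + 1)) = G" by (simp add: tau_eq_path G_def q_def)
  have closed: "closed_games \<Gamma>" and G: "G \<in> \<Gamma>"
    by (simp_all add: \<Gamma>_def closed_games_cl cl_self)
  have "fset (left_opts G) \<subseteq> \<Gamma>"
    using closed G unfolding closed_games_def by blast
  then have "path q \<in> \<Gamma>" by (simp add: G_def LL_def)
  then have star: "star \<in> \<Gamma>"
    unfolding star_eq_path using path_in_closed[OF closed, of q 1] q(2) by linarith
  have zero: "0 \<in> \<Gamma>" using zero_in_closed closed G by blast
  have star2: "star + star \<in> \<Gamma>" using closed star by (simp add: closed_games_def)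
  have sums: "sum_of q 0 0 0" "sum_of q 0 1 star" "sum_of q 0 2 (star + star)" "sum_of q 1 0 G"
    using sum_of_path[of q 0] sum_of_path[of q 1] sum_of_LL[of q]
      sum_of_plus[OF sum_of_path[of q 1] sum_of_path[of q 1]]
    by (simp_all add: star_eq_path G_def numeral_2_eq_2)
  have carrier: "carrier (misere_monoid \<Gamma>) =
    {misere_class \<Gamma> 0, misere_class \<Gamma> star, misere_class \<Gamma> (star + star), misere_class \<Gamma> G}"
  proof -
    have "misere_class \<Gamma> g \<in>
      {misere_class \<Gamma> 0, misere_class \<Gamma> star, misere_class \<Gamma> (star + star), misere_class \<Gamma> G}"
      if g: "g \<in> \<Gamma>" for g
    proof -
      obtain a m where am: "sum_of q a m g"
        using g cl_LL_path_sum_of unfolding \<Gamma>_def G_def by blast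
      note equiv = sum_of_equiv_mod[OF q am, folded G_def \<Gamma>_def]
      \<comment> \<open>For \<open>m = 0\<close> an even total gives \<open>0\<close> and an odd one
        \<open>G\<close>; for \<open>m > 0\<close> an even total gives \<open>star + star\<close>
        and an odd one \<open>star\<close>.\<close>
      have "equiv_mod \<Gamma> g 0 \<or> equiv_mod \<Gamma> g star \<or> equiv_mod \<Gamma> g (star + star) \<or> equiv_mod \<Gamma> g G"
        using sums[THEN equiv] by (cases "m = 0"; cases "even (a + m)") auto
      then show ?thesis
        using misere_class_eq_iff[OF g] zero star star2 G by blast
    qed
    then show ?thesis
      using zero star star2 G by (auto simp: misere_monoid_def)
  qed
  note outcome = sum_of_misere_outcome[OF q]
  have outcomes: "misere_outcome 0 = Outcome_N" "misere_outcome star = Outcome_P"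
    "misere_outcome (star + star) = Outcome_N" "misere_outcome G = Outcome_R"
    using sums[THEN outcome] by simp_all
  \<comment> \<open>\<open>0\<close> and \<open>star + star\<close> both have outcome N, so a test
    game is required: adding \<open>G\<close> gives R for \<open>0\<close> but P for
    \<open>star + star\<close>.\<close>
  have "misere_outcome (star + star + G) = Outcome_P"
    using outcome[OF sum_of_plus[OF sums(3,4)]] by simp
  then have "\<not> equiv_mod \<Gamma> 0 (star + star)"
    using G outcomes by (auto simp: equiv_mod_def intro!: bexI[of _ G])
  \<comment> \<open>Testing with \<open>0\<close> shows that equivalent games share their outcome,
    which separates the other five pairs.\<close>
  moreover have "misere_outcome g = misere_outcome h" if "equiv_mod \<Gamma> g h" for g h
    using that zero by (force simp: equiv_mod_def)
  then have "\<not> equiv_mod \<Gamma> 0 star" "\<not> equiv_mod \<Gamma> 0 G" "\<not> equiv_mod \<Gamma> star (star + star)"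
    "\<not> equiv_mod \<Gamma> star G" "\<not> equiv_mod \<Gamma> (star + star) G"
    using outcomes by force+
  ultimately have "card (carrier (misere_monoid \<Gamma>)) = 4"
    using zero star star2 G by (simp add: carrier misere_class_eq_iff)
  with carrier show ?thesis
    unfolding tau Let_def \<Gamma>_def by blast
qed

end
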